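(* Let $s\ge1$ be an integer, let $p,q\in(0,1)$ satisfy $\sum_{k=0}^{s}p^kq^{s-k}=1$, and let $X\sim\mathcal{B}^{(s)}(p)$ follow the $s$-Bernoulli distribution. Then the expectation and variance of $X$ are $$E(X)=\frac{p\left((s+1)p^{s}-1\right)}{p-q},\qquad V(X)=\frac{pq\left(1-(s+1)^2(pq)^s\right)}{(p-q)^2}\qquad\text{if }p\neq q,$$ and $$E(X)=\frac{s}{2},\qquad V(X)=\frac{s(s+2)}{12}\qquad\text{if }p=q.$$
   Context: The $s$-Bernoulli distribution $\mathcal{B}^{(s)}(p)$, where $p,q\in(0,1)$ satisfy $\sum_{k=0}^s p^kq^{s-k}=1$, is the law on $\{0,1,\dots,s\}$ with $\mathbb{P}(X=k)=p^kq^{s-k}$. *)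

theory Defs
  imports "HOL-Probability.Probability"
begin

text \<open>
  The \<open>s\<close>-Bernoulli distribution. Since \<open>q\<close> is determined by \<open>p\<close> only through the constraint
  \<open>(\<Sum>k=0..s. p ^ k * q ^ (s - k)) = 1\<close>, it is kept as an explicit parameter. The term is
  meaningful only under this constraint (and \<open>p, q \<ge> 0\<close>), as \<^const>\<open>embed_pmf\<close> is otherwise
  unspecified.
\<close>

definition s_bernoulli_pmf :: "nat \<Rightarrow> real \<Rightarrow> real \<Rightarrow> nat pmf" where
  "s_bernoulli_pmf s p q = embed_pmf (\<lambda>k. if k \<le> s then p ^ k * q ^ (s - k) else 0)"

lemma pmf_s_bernoulli:
  assumes "0 \<le> p" "0 \<le> q" "(\<Sum>k=0..s. p ^ k * q ^ (s - k)) = 1"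
  shows "pmf (s_bernoulli_pmf s p q) k = (if k \<le> s then p ^ k * q ^ (s - k) else 0)"
  unfolding s_bernoulli_pmf_def
proof (rule pmf_embed_pmf)
  let ?f = "\<lambda>k. if k \<le> s then p ^ k * q ^ (s - k) else 0"
  show nonneg: "0 \<le> ?f k" for k
    using assms by simp
  have "(\<integral>\<^sup>+ k. ennreal (?f k) \<partial>count_space UNIV) = (\<Sum>k\<in>{0..s}. ennreal (?f k))"
    by (rule nn_integral_count_space') auto
  also have "\<dots> = ennreal (\<Sum>k\<in>{0..s}. ?f k)"
    using nonneg by (rule sum_ennreal)
  also have "(\<Sum>k\<in>{0..s}. ?f k) = (\<Sum>k=0..s. p ^ k * q ^ (s - k))"
    by (intro sum.cong) auto
  finally show "(\<integral>\<^sup>+ k. ennreal (?f k) \<partial>count_space UNIV) = 1"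
    using assms by simp
qed

end

theory Submission imports Defs begin

text \<open>
  Summation by parts reduces the moments of the weights \<open>p ^ k * q ^ (s - k)\<close> to one another:
  multiplying by \<open>p - q\<close> telescopes, and lowers the degree of the polynomial in front of the
  weights by one. In degree zero this turns the normalisation into
  \<open>p ^ (s + 1) - q ^ (s + 1) = p - q\<close>, which removes \<open>q ^ (s + 1)\<close> from the higher moments.
  For \<open>p = q\<close> all weights coincide, so the law is uniform on \<open>{0..s}\<close>.
\<close>

lemma sum_by_parts_power:
  fixes p q :: "'a::comm_ring_1" and f :: "nat \<Rightarrow> 'a"
  shows "(p - q) * (\<Sum>k=0..s. f k * (p ^ k * q ^ (s - k))) =
    f (Suc s) * p ^ Suc s - f 0 * q ^ Suc s
      - p * (\<Sum>k=0..s. (f (Suc k) - f k) * (p ^ k * q ^ (s - k)))"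
proof (induction s)
  case 0
  show ?case by (simp add: algebra_simps)
next
  case (Suc s)
  \<comment> \<open>Raising \<open>s\<close> by one multiplies every old weight by \<open>q\<close>
    and adds the single weight \<open>p ^ Suc s\<close>. The function \<open>g\<close> is arbitrary
    because this is needed both for \<open>f\<close> and for its increments.\<close>
  have step: "(\<Sum>k=0..Suc s. g k * (p ^ k * q ^ (Suc s - k))) =
      q * (\<Sum>k=0..s. g k * (p ^ k * q ^ (s - k))) + g (Suc s) * p ^ Suc s" for g :: "nat \<Rightarrow> 'a"
  proof -
    have "(\<Sum>k=0..s. g k * (p ^ k * q ^ (Suc s - k))) =
        q * (\<Sum>k=0..s. g k * (p ^ k * q ^ (s - k)))"
      unfolding sum_distrib_left by (intro sum.cong) (auto simp: Suc_diff_le algebra_simps)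
    then show ?thesis by simp
  qed
  let ?A = "\<Sum>k=0..s. f k * (p ^ k * q ^ (s - k))"
  let ?B = "\<Sum>k=0..s. (f (Suc k) - f k) * (p ^ k * q ^ (s - k))"
  have "(p - q) * (q * ?A + f (Suc s) * p ^ Suc s) =
      q * ((p - q) * ?A) + (p - q) * (f (Suc s) * p ^ Suc s)"
    by (simp add: algebra_simps)
  also have "\<dots> = f (Suc (Suc s)) * p ^ Suc (Suc s) - f 0 * q ^ Suc (Suc s)
      - p * (q * ?B + (f (Suc (Suc s)) - f (Suc s)) * p ^ Suc s)"
    unfolding Suc.IH by (simp add: algebra_simps)
  finally show ?case unfolding step .
qed

text \<open>The support lies in the finite set \<open>{0..s}\<close>, so no integrability condition
  on \<open>h\<close> arises.\<close>

lemma integral_s_bernoulli_pmf: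
  fixes h :: "nat \<Rightarrow> real"
  assumes "0 \<le> p" "0 \<le> q" "(\<Sum>k=0..s. p ^ k * q ^ (s - k)) = 1"
  shows "measure_pmf.expectation (s_bernoulli_pmf s p q) h =
    (\<Sum>k=0..s. h k * (p ^ k * q ^ (s - k)))"
proof -
  have "measure_pmf.expectation (s_bernoulli_pmf s p q) h =
      (\<Sum>k\<in>{0..s}. pmf (s_bernoulli_pmf s p q) k *\<^sub>R h k)"
    by (rule integral_measure_pmf) (auto simp: set_pmf_iff pmf_s_bernoulli[OF assms] split: if_splits)
  then show ?thesis
    by (simp add: pmf_s_bernoulli[OF assms] mult.commute)
qed

lemma sum_of_nat: "(\<Sum>k=0..s. real k) = real s * (real s + 1) / 2"
  by (induction s) (simp_all add: field_simps)

lemma sum_of_nat_square: "(\<Sum>k=0..s. (real k)\<^sup>2) = real s * (real s + 1) * (2 * real s + 1) / 6"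
  by (induction s) (simp_all add: field_simps power2_eq_square)

theorem corollary3p1:
  fixes s :: nat and p q :: real and M :: "'a measure" and X :: "'a \<Rightarrow> nat"
  assumes "s \<ge> 1"
    and "p \<in> {0<..<1}" and "q \<in> {0<..<1}"
    and "(\<Sum>k=0..s. p ^ k * q ^ (s - k)) = 1"
    and "prob_space M"
    and "X \<in> measurable M (count_space UNIV)"
    and "distr M (count_space UNIV) X = measure_pmf (s_bernoulli_pmf s p q)"
  shows "(p \<noteq> q \<longrightarrow>
           prob_space.expectation M (\<lambda>\<omega>. real (X \<omega>)) =
             p * ((real s + 1) * p ^ s - 1) / (p - q) \<and>
           prob_space.variance M (\<lambda>\<omega>. real (X \<omega>)) =
             p * q * (1 - (real s + 1) ^ 2 * (p * q) ^ s) / (p - q) ^ 2) \<and>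
         (p = q \<longrightarrow>
           prob_space.expectation M (\<lambda>\<omega>. real (X \<omega>)) = real s / 2 \<and>
           prob_space.variance M (\<lambda>\<omega>. real (X \<omega>)) = real s * (real s + 2) / 12)"
proof -
  have pos: "0 \<le> p" "0 \<le> q" using assms(2,3) by auto
  note norm = assms(4)
  define S1 where "S1 = (\<Sum>k=0..s. real k * (p ^ k * q ^ (s - k)))"
  define S2 where "S2 = (\<Sum>k=0..s. (real k)\<^sup>2 * (p ^ k * q ^ (s - k)))"
  \<comment> \<open>With \<open>h\<close> arbitrary, this serves both the mean and the squared
    deviation from \<open>S1\<close>.\<close>
  have exp_X: "prob_space.expectation M (\<lambda>\<omega>. h (X \<omega>)) = (\<Sum>k=0..s. h k * (p ^ k * q ^ (s - k)))"
    for h :: "nat \<Rightarrow> real"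
  proof -
    have "prob_space.expectation M (\<lambda>\<omega>. h (X \<omega>)) =
        integral\<^sup>L (distr M (count_space UNIV) X) h"
      using assms(6) by (intro integral_distr[symmetric]) auto
    then show ?thesis
      by (simp only: assms(7) integral_s_bernoulli_pmf[OF pos norm])
  qed
  have E: "prob_space.expectation M (\<lambda>\<omega>. real (X \<omega>)) = S1"
    unfolding S1_def by (rule exp_X)
  have "prob_space.variance M (\<lambda>\<omega>. real (X \<omega>)) =
      (\<Sum>k=0..s. (real k - S1)\<^sup>2 * (p ^ k * q ^ (s - k)))"
    unfolding E by (rule exp_X)
  also have "\<dots> = (\<Sum>k=0..s. (real k)\<^sup>2 * (p ^ k * q ^ (s - k))
      - 2 * S1 * (real k * (p ^ k * q ^ (s - k))) + S1\<^sup>2 * (p ^ k * q ^ (s - k)))"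
    by (intro sum.cong) (auto simp: power2_eq_square algebra_simps)
  also have "\<dots> = S2 - 2 * S1 * S1 + S1\<^sup>2 * (\<Sum>k=0..s. p ^ k * q ^ (s - k))"
    by (simp only: sum.distrib sum_subtractf S2_def[symmetric] S1_def[symmetric]
        flip: sum_distrib_left)
  finally have V: "prob_space.variance M (\<lambda>\<omega>. real (X \<omega>)) = S2 - S1\<^sup>2"
    using norm by (simp add: power2_eq_square)
  show ?thesis
    \<comment> \<open>The order matters: the variance contains the expectation, so rewriting with
      \<open>E\<close> first would destroy the left-hand side of \<open>V\<close>.\<close>
    unfolding V unfolding E
  proof (intro conjI impI)
    assume "p \<noteq> q"
    then have d: "p - q \<noteq> 0" by simp
    \<comment> \<open>A constant has zero increments, so only the boundary terms survive.\<close>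
    have P0: "p - q = p ^ Suc s - q ^ Suc s"
      using sum_by_parts_power[of p q "\<lambda>_. 1" s] norm by simp
    \<comment> \<open>Here \<open>f 0 = 0\<close> removes the power of \<open>q\<close>, and all
      increments are 1, so the remaining sum is the normalisation.\<close>
    have P1: "(p - q) * S1 = p * ((real s + 1) * p ^ s - 1)"
      using sum_by_parts_power[of p q real s] norm unfolding S1_def
      by (simp add: algebra_simps)
    have incr: "(real (Suc k))\<^sup>2 - (real k)\<^sup>2 = 2 * real k + 1" for k
      by (simp add: power2_eq_square algebra_simps)
    have "(\<Sum>k=0..s. (2 * real k + 1) * (p ^ k * q ^ (s - k))) = 2 * S1 + 1"
      using norm unfolding S1_def
      by (simp add: distrib_right sum.distrib sum_distrib_left mult.assoc)
    then have P2: "(p - q) * S2 = (real s + 1)\<^sup>2 * p ^ Suc s - p * (2 * S1 + 1)"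
      using sum_by_parts_power[of p q "\<lambda>k. (real k)\<^sup>2" s] unfolding incr S2_def
      by (simp add: add.commute)
    show "S1 = p * ((real s + 1) * p ^ s - 1) / (p - q)"
      using P1 d by (simp add: field_simps)
    define n where "n = real s + 1"
    have "(p - q)\<^sup>2 * (S2 - S1\<^sup>2) =
        (p - q) * ((p - q) * S2) - ((p - q) * S1)\<^sup>2"
      by (simp add: power2_eq_square algebra_simps)
    also have "\<dots> = (p - q) * (n\<^sup>2 * p ^ Suc s - p) - 2 * p * ((p - q) * S1) - ((p - q) * S1)\<^sup>2"
      unfolding P2 n_def by (simp add: algebra_simps)
    \<comment> \<open>Since \<open>(p - q) * S1 = n * p ^ Suc s - p\<close>, the last two terms add
      up to \<open>p\<^sup>2 - (n * p ^ Suc s)\<^sup>2\<close>: the parts linear in \<open>n\<close>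
      cancel.\<close>
    also have "\<dots> = n\<^sup>2 * p ^ Suc s * ((p - q) - p ^ Suc s) + p * q"
      unfolding P1 n_def[symmetric] by (simp add: power2_eq_square algebra_simps)
    \<comment> \<open>By \<open>P0\<close> the bracket equals \<open>- (q ^ Suc s)\<close>, which
      produces the power of \<open>p * q\<close>.\<close>
    also have "\<dots> = p * q * (1 - n\<^sup>2 * (p * q) ^ s)"
      unfolding P0 by (simp add: power_mult_distrib algebra_simps)
    finally show "S2 - S1\<^sup>2 = p * q * (1 - (real s + 1) ^ 2 * (p * q) ^ s) / (p - q) ^ 2"
      using d unfolding n_def by (simp add: eq_divide_eq mult.commute)
  next
    assume eq: "p = q"
    have w: "p ^ k * q ^ (s - k) = p ^ s" if "k \<le> s" for k
      using that unfolding eq by (simp flip: power_add)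
    have uniform: "(real s + 1) * p ^ s = 1"
      using norm w by (simp add: add.commute)
    have "S1 = (\<Sum>k=0..s. real k) * p ^ s"
      unfolding S1_def sum_distrib_right by (intro sum.cong) (auto simp: w)
    \<comment> \<open>The factor \<open>real s + 1\<close> of the power sum is paired with
      \<open>p ^ s\<close>, so that \<open>uniform\<close> turns the product into 1.\<close>
    also have "\<dots> = real s / 2 * ((real s + 1) * p ^ s)"
      unfolding sum_of_nat by simp
    finally show S1: "S1 = real s / 2"
      unfolding uniform by simp
    have "S2 = (\<Sum>k=0..s. (real k)\<^sup>2) * p ^ s"
      unfolding S2_def sum_distrib_right by (intro sum.cong) (auto simp: w)
    also have "\<dots> = real s * (2 * real s + 1) / 6 * ((real s + 1) * p ^ s)"
      unfolding sum_of_nat_square by simp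
    finally have "S2 = real s * (2 * real s + 1) / 6"
      unfolding uniform by simp
    then show "S2 - S1\<^sup>2 = real s * (real s + 2) / 12"
      unfolding S1 by (simp add: field_simps power2_eq_square)
  qed
qed

end
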